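(* Let $G_1$ and $G_2$ be vertex-disjoint graphs on $n_1$ and $n_2$ vertices respectively. Then, as identities of rational functions in $x$: (a) $$\begin{aligned} f_{L(G_1\underset{=}{\vee}G_2)}(x)&=\det\big((x-n_1)I_{n_2}-L(G_2)\big)\,\det\big((x-n_1+1)I_{n_1}+D(G_1)\big)\\ &\cdot\det\Big((x-n_1-n_2+1)I_{n_1}-L(G_1)+D(G_1)-A(\overline{G_1})\big((x-n_1+1)I_{n_1}+D(G_1)\big)^{-1}A(\overline{G_1})\Big)\\ &\cdot\Big[1-\Gamma_{L(G_2)}(x-n_1)\,\Gamma_{L(G_1)-D(G_1)+A(\overline{G_1})((x-n_1+1)I_{n_1}+D(G_1))^{-1}A(\overline{G_1})}(x-n_1-n_2+1)\Big].\end{aligned}$$ (b) $$\begin{aligned} f_{L(G_1\veebar G_2)}(x)&=\det\big((x-n_1)I_{n_2}-L(G_2)\big)\,\det\big(xI_{n_1}-D(G_1)\big)\\ &\cdot\det\Big((x-n_2)I_{n_1}-L(G_1)-D(G_1)-A(G_1)\big(xI_{n_1}-D(G_1)\big)^{-1}A(G_1)\Big)\\ &\cdot\Big[1-\Gamma_{L(G_2)}(x-n_1)\,\Gamma_{L(G_1)+D(G_1)+A(G_1)(xI_{n_1}-D(G_1))^{-1}A(G_1)}(x-n_2)\Big].\end{aligned}$$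
   Context: Graphs are finite, undirected and simple. $A(G)$ is the adjacency matrix, $D(G)$ the diagonal matrix of vertex degrees, $L(G)=D(G)-A(G)$ the Laplacian matrix, and $\overline{G}$ the complement of $G$. For an $n\times n$ matrix $M$, $f_M(x)=\det(xI_n-M)$, and the coronal of $M$ is $\Gamma_M(y)=\mathbf 1_n^T(yI_n-M)^{-1}\mathbf 1_n$, where $\mathbf 1_n$ is the all-ones column. When the entries of $M$ depend on $x$, $\Gamma_M(x-c)$ means $\mathbf 1_n^T((x-c)I_n-M)^{-1}\mathbf 1_n$ with that same $x$. Let $V(G_1)=\{u_1,\dots,u_{n_1}\}$. The join $G_1\vee G_2$ is the disjoint union of $G_1$ and $G_2$ together with all edges between $V(G_1)$ and $V(G_2)$. The NS (Neighbors Splitting) join $G_1\veebar G_2$ is obtained from $G_1\vee G_2$ by adding new vertices $u_1',\dots,u_{n_1}'$ and joining $u_i'$ to $u_j$ if and only if $u_iu_j\in E(G_1)$. The NNS (Non Neighbors Splitting) join $G_1\underset{=}{\vee}G_2$ is obtained from $G_1\vee G_2$ by adding new vertices $u_1',\dots,u_{n_1}'$ and joining $u_i'$ to $u_j$ if and only if $i\ne j$ and $u_iu_j\notin E(G_1)$. *)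

theory Defs
  imports
    "Jordan_Normal_Form.Char_Poly"
    "Jordan_Normal_Form.Gauss_Jordan_Elimination"
    "HOL-Computational_Algebra.Fraction_Field"
begin

section \<open>Graphs\<close>

record 'a ugraph =
  verts :: "'a set"
  edges :: "'a set set"

definition simple_graph :: "'a ugraph \<Rightarrow> bool" where
  "simple_graph G \<longleftrightarrow> finite (verts G) \<and> (\<forall>e\<in>edges G. e \<subseteq> verts G \<and> card e = 2)"

definition degree_of :: "'a ugraph \<Rightarrow> 'a \<Rightarrow> nat" where
  "degree_of G v = card {e \<in> edges G. v \<in> e}"

definition complement :: "'a ugraph \<Rightarrow> 'a ugraph" where
  "complement G = \<lparr>verts = verts G,
     edges = {{u, w} | u w. u \<in> verts G \<and> w \<in> verts G \<and> u \<noteq> w \<and> {u, w} \<notin> edges G}\<rparr>"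

text \<open>The disjoint union of the vertex sets is the sum of the two vertex types, so the two graphs
  are vertex-disjoint inside the join even if they share vertex names.\<close>

definition join :: "'a ugraph \<Rightarrow> 'b ugraph \<Rightarrow> ('a + 'b) ugraph" where
  "join G1 G2 = \<lparr>verts = Inl ` verts G1 \<union> Inr ` verts G2,
     edges = (`) Inl ` edges G1 \<union> (`) Inr ` edges G2
       \<union> {{Inl u, Inr v} | u v. u \<in> verts G1 \<and> v \<in> verts G2}\<rparr>"

text \<open>In the two splitting joins, a vertex \<open>p\<close> of the join is \<open>Inl p\<close>, and the new
  vertex \<open>u'\<close> attached to a vertex \<open>u\<close> of \<open>G1\<close> is \<open>Inr u\<close>.\<close>

definition ns_join :: "'a ugraph \<Rightarrow> 'b ugraph \<Rightarrow> (('a + 'b) + 'a) ugraph" where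
  "ns_join G1 G2 = \<lparr>verts = Inl ` verts (join G1 G2) \<union> Inr ` verts G1,
     edges = (`) Inl ` edges (join G1 G2)
       \<union> {{Inr u, Inl (Inl w)} | u w. u \<in> verts G1 \<and> w \<in> verts G1 \<and> {u, w} \<in> edges G1}\<rparr>"

definition nns_join :: "'a ugraph \<Rightarrow> 'b ugraph \<Rightarrow> (('a + 'b) + 'a) ugraph" where
  "nns_join G1 G2 = \<lparr>verts = Inl ` verts (join G1 G2) \<union> Inr ` verts G1,
     edges = (`) Inl ` edges (join G1 G2)
       \<union> {{Inr u, Inl (Inl w)} | u w.
            u \<in> verts G1 \<and> w \<in> verts G1 \<and> u \<noteq> w \<and> {u, w} \<notin> edges G1}\<rparr>"


section \<open>Matrices of a graph\<close>

text \<open>Rows and columns are indexed by an enumeration of the vertices.  The entries are taken in an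
  arbitrary ring, since the same matrices are needed over the reals and over the field of rational
  functions.\<close>

definition vertex_enum :: "'a ugraph \<Rightarrow> 'a list \<Rightarrow> bool" where
  "vertex_enum G vs \<longleftrightarrow> distinct vs \<and> set vs = verts G"

definition adjacency_matrix :: "'a ugraph \<Rightarrow> 'a list \<Rightarrow> 'c :: ring_1 mat" where
  "adjacency_matrix G vs = mat (length vs) (length vs)
     (\<lambda>(i, j). if {vs ! i, vs ! j} \<in> edges G then 1 else 0)"

definition degree_matrix :: "'a ugraph \<Rightarrow> 'a list \<Rightarrow> 'c :: ring_1 mat" where
  "degree_matrix G vs = mat (length vs) (length vs)
     (\<lambda>(i, j). if i = j then of_nat (degree_of G (vs ! i)) else 0)"

definition laplacian :: "'a ugraph \<Rightarrow> 'a list \<Rightarrow> 'c :: ring_1 mat" where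
  "laplacian G vs = degree_matrix G vs - adjacency_matrix G vs"


section \<open>Coronals and rational functions\<close>

text \<open>The value is unspecified when the matrix is singular.\<close>

definition mat_inv :: "'c :: field mat \<Rightarrow> 'c mat" where
  "mat_inv M = the (mat_inverse M)"

lemma mat_inv_right_left:
  fixes M :: "'c :: field mat"
  assumes M: "M \<in> carrier_mat n n" and d: "det M \<noteq> 0"
  shows "M * mat_inv M = 1\<^sub>m n" "mat_inv M * M = 1\<^sub>m n" "mat_inv M \<in> carrier_mat n n"
proof -
  have "mat_inverse M \<noteq> None"
    using mat_inverse(1)[OF M, where b = "()"] det_non_zero_imp_unit[OF M d, where b = "()"] by blast
  then obtain B where "mat_inverse M = Some B" by blast
  with mat_inverse(2)[OF M this]
  show "M * mat_inv M = 1\<^sub>m n" "mat_inv M * M = 1\<^sub>m n" "mat_inv M \<in> carrier_mat n n"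
    by (simp_all add: mat_inv_def)
qed

definition ones_vec :: "nat \<Rightarrow> 'c :: semiring_1 vec" where
  "ones_vec n = vec n (\<lambda>_. 1)"

definition coronal :: "'c :: field mat \<Rightarrow> 'c \<Rightarrow> 'c" where
  "coronal M y = (let n = dim_row M in
     ones_vec n \<bullet> (mat_inv (y \<cdot>\<^sub>m 1\<^sub>m n - M) *\<^sub>v ones_vec n))"

type_synonym ratfun = "real poly fract"

definition poly_ratfun :: "real poly \<Rightarrow> ratfun" where
  "poly_ratfun p = Fract p 1"

definition ratfun_X :: ratfun where
  "ratfun_X = poly_ratfun [:0, 1:]"

end

theory Submission
  imports Defs "HOL-Combinatorics.Permutations"
begin

text \<open>Both joins are the same construction, with the new vertices attached along the edges of a graph
  \<open>H\<close> on the vertices of \<open>G1\<close>: \<open>H = G1\<close> for the NS join and \<open>H = complement G1\<close> for the NNS join.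
  Listing the vertices as \<open>G2\<close>, new vertices, \<open>G1\<close>, the matrix \<open>x I - L\<close> is a block matrix in which
  \<open>G2\<close> interacts only with \<open>G1\<close>, through an all-ones block \<open>J\<close>.  Eliminating \<open>G2\<close> by a Schur
  complement subtracts \<open>\<Gamma> J\<close> from the \<open>G1\<close> block, where \<open>\<Gamma>\<close> is the coronal of \<open>L(G2)\<close>; a second Schur
  complement eliminates the new vertices, and the rank-one perturbation \<open>\<Gamma> J\<close> contributes the last
  factor.  All matrices inverted are nonsingular over the rational functions: their determinants are,
  up to nonzero factors, characteristic polynomials of principal submatrices of \<open>L\<close>.\<close>

section \<open>Schur complements and constant perturbations\<close>

text \<open>Right multiplication by the block unitriangular \<open>?U\<close>, which has determinant
  1, clears the block \<open>B\<close> and leaves a block lower triangular matrix. Supplying the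
  right inverse \<open>N\<close> as a parameter avoids division, so any integral domain will
  do.\<close>

lemma det_schur_upper_left:
  fixes A :: "'c :: idom mat"
  assumes A: "A \<in> carrier_mat n n" and B: "B \<in> carrier_mat n m"
    and C: "C \<in> carrier_mat m n" and D: "D \<in> carrier_mat m m"
    and N: "N \<in> carrier_mat n n" and AN: "A * N = 1\<^sub>m n"
  shows "det (four_block_mat A B C D) = det A * det (D - C * N * B)"
proof -
  let ?U = "four_block_mat (1\<^sub>m n) (- (N * B)) (0\<^sub>m m n) (1\<^sub>m m)"
  have NB: "- (N * B) \<in> carrier_mat n m" using N B by simp
  have "four_block_mat A B C D * ?U = four_block_mat (A * 1\<^sub>m n + B * 0\<^sub>m m n)
      (A * - (N * B) + B * 1\<^sub>m m) (C * 1\<^sub>m n + D * 0\<^sub>m m n) (C * - (N * B) + D * 1\<^sub>m m)"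
    by (rule mult_four_block_mat[OF A B C D one_carrier_mat NB zero_carrier_mat one_carrier_mat])
  also have "A * - (N * B) + B * 1\<^sub>m m = 0\<^sub>m n m"
  proof -
    have "A * - (N * B) = - (A * N * B)"
      using A N B by (simp add: assoc_mult_mat[of _ n n _ n _ m]) 
    then show ?thesis using B by (simp add: AN)
  qed
  also have "C * - (N * B) + D * 1\<^sub>m m = D - C * N * B"
  proof -
    have "C * - (N * B) = - (C * N * B)"
      using C N B by (simp add: assoc_mult_mat[of _ m n _ n _ m])
    then show ?thesis using C N B D by (auto simp: add.commute)
  qed
  finally have eq: "four_block_mat A B C D * ?U = four_block_mat A (0\<^sub>m n m) C (D - C * N * B)"
    using A B C D by simp
  have "det (four_block_mat A B C D) * det ?U = det (four_block_mat A B C D * ?U)"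
    using A B C D by (intro det_mult[symmetric, where n = "n + m"]) auto
  also have "\<dots> = det A * det (D - C * N * B)"
    unfolding eq using A B C D N by (intro det_four_block_mat_upper_right_zero) auto
  also have "det ?U = 1"
    using det_four_block_mat_lower_left_zero[OF one_carrier_mat NB refl one_carrier_mat] by simp
  finally show ?thesis by simp
qed

text \<open>Here the multiplier is unit lower triangular and clears \<open>C\<close> by means of
  \<open>D\<close>. Having both eliminations allows one bordered determinant to be evaluated in two
  ways.\<close>

lemma det_schur_lower_right:
  fixes A :: "'c :: idom mat"
  assumes A: "A \<in> carrier_mat n n" and B: "B \<in> carrier_mat n m"
    and C: "C \<in> carrier_mat m n" and D: "D \<in> carrier_mat m m"
    and N: "N \<in> carrier_mat m m" and DN: "D * N = 1\<^sub>m m"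
  shows "det (four_block_mat A B C D) = det (A - B * N * C) * det D"
proof -
  let ?U = "four_block_mat (1\<^sub>m n) (0\<^sub>m n m) (- (N * C)) (1\<^sub>m m)"
  have NC: "- (N * C) \<in> carrier_mat m n" using N C by simp
  have "four_block_mat A B C D * ?U = four_block_mat (A * 1\<^sub>m n + B * - (N * C))
      (A * 0\<^sub>m n m + B * 1\<^sub>m m) (C * 1\<^sub>m n + D * - (N * C)) (C * 0\<^sub>m n m + D * 1\<^sub>m m)"
    by (rule mult_four_block_mat[OF A B C D one_carrier_mat zero_carrier_mat NC one_carrier_mat])
  also have "C * 1\<^sub>m n + D * - (N * C) = 0\<^sub>m m n"
  proof -
    have "D * - (N * C) = - (D * N * C)"
      using D N C by (simp add: assoc_mult_mat[of _ m m _ m _ n])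
    then show ?thesis using C by (auto simp: DN)
  qed
  also have "A * 1\<^sub>m n + B * - (N * C) = A - B * N * C"
  proof -
    have "B * - (N * C) = - (B * N * C)"
      using C N B by (simp add: assoc_mult_mat[of _ n m _ m _ n])
    then show ?thesis using C N B A by auto
  qed
  finally have eq: "four_block_mat A B C D * ?U = four_block_mat (A - B * N * C) B (0\<^sub>m m n) D"
    using A B C D by simp
  have "det (four_block_mat A B C D) * det ?U = det (four_block_mat A B C D * ?U)"
    using A B C D by (intro det_mult[symmetric, where n = "n + m"]) auto
  also have "\<dots> = det (A - B * N * C) * det D"
    unfolding eq using A B C D N by (intro det_four_block_mat_lower_left_zero) auto
  also have "det ?U = 1"
    using det_four_block_mat_upper_right_zero[OF one_carrier_mat refl NC one_carrier_mat] by simp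
  finally show ?thesis by simp
qed

lemma coronal_eq:
  "M \<in> carrier_mat n n \<Longrightarrow>
    coronal M y = ones_vec n \<bullet> (mat_inv (y \<cdot>\<^sub>m 1\<^sub>m n - M) *\<^sub>v ones_vec n)"
  by (auto simp: coronal_def Let_def)

text \<open>Both Schur complements of the bordered matrix with corner 1 are compared.\<close>

lemma det_minus_const_mat:
  fixes S :: "'c :: field mat"
  assumes S: "S \<in> carrier_mat n n" and d: "det S \<noteq> 0"
  shows "det (S - mat n n (\<lambda>_. c)) = det S * (1 - c * (ones_vec n \<bullet> (mat_inv S *\<^sub>v ones_vec n)))"
proof -
  let ?R = "mat 1 n (\<lambda>_. c)" and ?C = "mat n 1 (\<lambda>_. 1 :: 'c)"
  note N = mat_inv_right_left[OF S d]
  \<comment> \<open>The constant matrix has rank at most one: the all-ones column times the constant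
    row is exactly what eliminating the corner 1 subtracts from \<open>S\<close>.\<close>
  have "mat n n (\<lambda>_. c) = ?C * 1\<^sub>m 1 * ?R"
    by (rule eq_matI) (auto simp: scalar_prod_def)
  then have "det (S - mat n n (\<lambda>_. c)) = det (four_block_mat (1\<^sub>m 1) ?R ?C S)"
    using det_schur_upper_left[of "1\<^sub>m 1" 1 ?R n ?C S "1\<^sub>m 1"] S by simp
  also have "\<dots> = det (1\<^sub>m 1 - ?R * mat_inv S * ?C) * det S"
    by (rule det_schur_lower_right[OF _ _ _ S N(3) N(1)]) auto
  also have "?R * mat_inv S * ?C = ?R * (mat_inv S * ?C)"
    using N(3) by (intro assoc_mult_mat) auto
  also have "(?R * (mat_inv S * ?C)) $$ (0, 0) = c * (ones_vec n \<bullet> (mat_inv S *\<^sub>v ones_vec n))"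
  proof -
    have "row ?R 0 = c \<cdot>\<^sub>v ones_vec n" "col ?C 0 = ones_vec n"
      by (auto simp: ones_vec_def)
    moreover have "(?R * (mat_inv S * ?C)) $$ (0, 0) = row ?R 0 \<bullet> (mat_inv S *\<^sub>v col ?C 0)"
      using N(3) by (simp add: col_mult2[of _ n n _ 1])
    ultimately show ?thesis using N(3)
      by (simp add: ones_vec_def)
  qed
  then have "det (1\<^sub>m 1 - ?R * (mat_inv S * ?C)) = 1 - c * (ones_vec n \<bullet> (mat_inv S *\<^sub>v ones_vec n))"
    using N(3) by (subst det_single) auto
  finally show ?thesis by simp
qed

text \<open>\<open>Q\<close> stands for \<open>G2\<close>, \<open>W\<close> for the new vertices and
  \<open>P\<close> for \<open>G1\<close>. The borders vanish on the first \<open>m\<close> indices,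
  so eliminating \<open>Q\<close> changes only \<open>P\<close>, and changes it by a constant;
  eliminating \<open>W\<close> then gives \<open>S\<close> minus a constant matrix.\<close>

lemma det_join_block:
  fixes Q :: "'c :: field mat"
  assumes Q: "Q \<in> carrier_mat k k" and W: "W \<in> carrier_mat m m" and B: "B \<in> carrier_mat m n"
    and C: "C \<in> carrier_mat n m" and P: "P \<in> carrier_mat n n"
    and dQ: "det Q \<noteq> 0" and dW: "det W \<noteq> 0" and dM: "det (four_block_mat W B C P) \<noteq> 0"
  defines "S \<equiv> P - C * mat_inv W * B"
  shows "det (four_block_mat Q (mat k (m + n) (\<lambda>(i, j). if j < m then 0 else 1))
      (mat (m + n) k (\<lambda>(i, j). if i < m then 0 else 1)) (four_block_mat W B C P))
    = det Q * det W * det S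
      * (1 - (ones_vec k \<bullet> (mat_inv Q *\<^sub>v ones_vec k)) * (ones_vec n \<bullet> (mat_inv S *\<^sub>v ones_vec n)))"
proof -
  let ?K = "mat k (m + n) (\<lambda>(i, j). if j < m then 0 else 1)"
  let ?T = "mat (m + n) k (\<lambda>(i, j). if i < m then 0 else 1)"
  let ?M = "four_block_mat W B C P"
  define c where "c = ones_vec k \<bullet> (mat_inv Q *\<^sub>v ones_vec k)"
  note NQ = mat_inv_right_left[OF Q dQ] and NW = mat_inv_right_left[OF W dW]
  have M: "?M \<in> carrier_mat (m + n) (m + n)" using W P by simp
  have S: "S \<in> carrier_mat n n" using NW P C B unfolding S_def by auto
  \<comment> \<open>Invertibility of \<open>S\<close> is not assumed directly: it follows from that
    of the whole block \<open>?M\<close>, since \<open>det S\<close> is a factor of its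
    determinant.\<close>
  have "det ?M = det W * det S"
    unfolding S_def by (rule det_schur_upper_left[OF W B C P NW(3) NW(1)])
  with dM have dS: "det S \<noteq> 0" by simp
  have col: "col ?K j = (if j < m then 0\<^sub>v k else ones_vec k)" if "j < m + n" for j
    using that by (auto simp: ones_vec_def)
  have row: "row ?T i = (if i < m then 0\<^sub>v k else ones_vec k)" if "i < m + n" for i
    using that by (auto simp: ones_vec_def)
  \<comment> \<open>Rows of \<open>?T\<close> and columns of \<open>?K\<close> are either zero or
    all ones, so each entry is 0 or the full sum \<open>c\<close> of the entries of
    \<open>mat_inv Q\<close>.\<close>
  have e: "(?T * mat_inv Q * ?K) $$ (i, j) = (if i < m \<or> j < m then 0 else c)"
    if ij: "i < m + n" "j < m + n" for i j
  proof -
    have "?T * mat_inv Q * ?K = ?T * (mat_inv Q * ?K)"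
      using NQ(3) by (intro assoc_mult_mat) auto
    then have "(?T * mat_inv Q * ?K) $$ (i, j) = row ?T i \<bullet> (mat_inv Q *\<^sub>v col ?K j)"
      using ij NQ(3) by (simp add: col_mult2[of _ k k _ "m + n"])
    moreover have o: "(ones_vec k :: 'c vec) \<in> carrier_vec k" by (simp add: ones_vec_def)
    moreover have "mat_inv Q *\<^sub>v ones_vec k \<in> carrier_vec k" using NQ(3) o by (rule mult_mat_vec_carrier)
    moreover have "mat_inv Q *\<^sub>v 0\<^sub>v k = 0\<^sub>v k"
      using NQ(3) by (intro eq_vecI) auto
    moreover have "ones_vec k \<bullet> 0\<^sub>v k = (0 :: 'c)"
      using o by simp
    ultimately show ?thesis
      unfolding col[OF ij(2)] row[OF ij(1)] using NQ(3)
      by (auto simp: c_def)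
  qed
  have "?M - ?T * mat_inv Q * ?K = four_block_mat W B C (P - mat n n (\<lambda>_. c))"
    using W B C P by (intro eq_matI) (auto simp: e simp del: index_mult_mat(1))
  then have "det (four_block_mat Q ?K ?T ?M) = det Q * det (four_block_mat W B C (P - mat n n (\<lambda>_. c)))"
    using det_schur_upper_left[OF Q _ _ M NQ(3) NQ(1), of ?K ?T] by simp
  also have "det (four_block_mat W B C (P - mat n n (\<lambda>_. c)))
      = det W * det (P - mat n n (\<lambda>_. c) - C * mat_inv W * B)"
    by (rule det_schur_upper_left[OF W B C _ NW(3) NW(1)]) (use P in auto)
  also have "P - mat n n (\<lambda>_. c) - C * mat_inv W * B = S - mat n n (\<lambda>_. c)"
    unfolding S_def using P C NW B by (intro eq_matI) auto
  also note det_minus_const_mat[OF S dS]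
  finally show ?thesis by (simp add: c_def)
qed

section \<open>Matrices indexed by lists of labels\<close>

text \<open>Entries depend on labels rather than positions, so block decompositions come from
  appending lists, and changing the vertex order changes only the lists.\<close>

definition kernel_mat :: "('v \<Rightarrow> 'w \<Rightarrow> 'c) \<Rightarrow> 'v list \<Rightarrow> 'w list \<Rightarrow> 'c mat" where
  "kernel_mat f xs ys = mat (length xs) (length ys) (\<lambda>(i, j). f (xs ! i) (ys ! j))"

lemma kernel_mat_carrier [simp]: "kernel_mat f xs ys \<in> carrier_mat (length xs) (length ys)"
  by (simp add: kernel_mat_def)

lemma kernel_mat_append:
  "kernel_mat f (xs @ xs') (ys @ ys')
    = four_block_mat (kernel_mat f xs ys) (kernel_mat f xs ys') (kernel_mat f xs' ys) (kernel_mat f xs' ys')"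
  by (rule eq_matI) (auto simp: kernel_mat_def nth_append)

text \<open>Reordering the labels permutes rows and columns by the same permutation
  \<open>p\<close>, and the two signs cancel.\<close>

lemma det_kernel_mat_reorder:
  fixes f :: "'v \<Rightarrow> 'v \<Rightarrow> 'c :: comm_ring_1"
  assumes "distinct xs" "distinct ys" "set xs = set ys"
  shows "det (kernel_mat f xs xs) = det (kernel_mat f ys ys)"
proof -
  let ?n = "length ys"
  have "mset xs = mset ys" using assms by (simp add: set_eq_iff_mset_eq_distinct)
  then obtain p where p: "p permutes {..<?n}" and xs: "permute_list p ys = xs"
    by (rule mset_eq_permutation)
  have p0: "p permutes {0..<?n}" using p by (simp add: lessThan_atLeast0)
  have lt: "p i < ?n" if "i < ?n" for i using permutes_in_image[OF p, of i] that by simp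
  let ?Y = "kernel_mat f ys ys"
  let ?R = "mat ?n ?n (\<lambda>(i, j). ?Y $$ (p i, j))"
  \<comment> \<open>\<open>?R\<close> has the rows permuted; permuting the columns as well is a row
    permutation of its transpose.\<close>
  have "kernel_mat f xs xs = transpose_mat (mat ?n ?n (\<lambda>(i, j). transpose_mat ?R $$ (p i, j)))"
    using xs[symmetric] by (intro eq_matI) (auto simp: kernel_mat_def permute_list_nth[OF p] lt)
  then have "det (kernel_mat f xs xs) = det (mat ?n ?n (\<lambda>(i, j). transpose_mat ?R $$ (p i, j)))"
    using det_transpose[of "mat ?n ?n (\<lambda>(i, j). transpose_mat ?R $$ (p i, j))" ?n] by simp
  also have "\<dots> = signof p * det (transpose_mat ?R)"
    by (rule det_permute_rows[OF _ p0]) simp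
  also have "det (transpose_mat ?R) = det ?R" by (rule det_transpose[of _ ?n]) simp
  also have "\<dots> = signof p * det ?Y" by (rule det_permute_rows[OF _ p0]) simp
  finally show ?thesis by (simp add: sign_def)
qed

section \<open>Characteristic polynomials inside the rational functions\<close>

lemma poly_ratfun_comm_ring_hom: "comm_ring_hom poly_ratfun"
  by unfold_locales (simp_all add: poly_ratfun_def Zero_fract_def One_fract_def)

lemma poly_ratfun_eq_0_iff [simp]: "poly_ratfun p = 0 \<longleftrightarrow> p = 0"
  by (simp add: poly_ratfun_def Zero_fract_def eq_fract)

lemma poly_ratfun_of_int: "poly_ratfun [:of_int k:] = of_int k"
proof -
  interpret comm_ring_hom poly_ratfun by (rule poly_ratfun_comm_ring_hom)
  show ?thesis by (metis hom_of_int of_int_poly)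
qed

text \<open>An integer-valued kernel yields both the real matrix whose characteristic polynomial is taken
  and its copy over the rational functions.\<close>

definition char_kernel :: "('v \<Rightarrow> 'v \<Rightarrow> int) \<Rightarrow> 'v \<Rightarrow> 'v \<Rightarrow> ratfun" where
  "char_kernel f a b = (if a = b then ratfun_X else 0) - of_int (f a b)"

text \<open>A ring homomorphism commutes with determinants. Distinctness makes equal labels the same
  as equal positions, so the variable sits exactly on the diagonal.\<close>

lemma poly_ratfun_char_poly:
  assumes "distinct xs"
  shows "poly_ratfun (char_poly (kernel_mat (\<lambda>a b. of_int (f a b)) xs xs))
    = det (kernel_mat (char_kernel f) xs xs)"
proof -
  interpret comm_ring_hom poly_ratfun by (rule poly_ratfun_comm_ring_hom)
  have diag: "poly_ratfun [:- of_int k, 1:] = ratfun_X - of_int k" for k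
  proof -
    have "[:- of_int k, 1:] = [:0, 1:] + [:of_int (- k) :: real:]" by simp
    then show ?thesis by (simp only: hom_add poly_ratfun_of_int) (simp add: ratfun_X_def)
  qed
  have "map_mat poly_ratfun (char_poly_matrix (kernel_mat (\<lambda>a b. of_int (f a b)) xs xs))
      = kernel_mat (char_kernel f) xs xs"
    using assms
    by (intro eq_matI)
      (auto simp: char_poly_matrix_def kernel_mat_def char_kernel_def
        diag one_pCons nth_eq_iff_index_eq poly_ratfun_of_int poly_ratfun_of_int[of "- _", simplified])
  then show ?thesis unfolding char_poly_def hom_det[symmetric] by simp
qed

text \<open>A characteristic polynomial is monic, and the embedding into rational functions is
  injective. Since \<open>xs\<close> may be any distinct list, this covers every principal submatrix
  of a Laplacian.\<close>

lemma det_char_kernel_nonzero: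
  assumes "distinct xs"
  shows "det (kernel_mat (char_kernel f) xs xs) \<noteq> 0"
proof -
  have "char_poly (kernel_mat (\<lambda>a b. of_int (f a b) :: real) xs xs) \<noteq> 0"
    using degree_monic_char_poly[OF kernel_mat_carrier, of "\<lambda>a b. of_int (f a b) :: real" xs]
    by auto
  then show ?thesis unfolding poly_ratfun_char_poly[OF assms, symmetric] by simp
qed


section \<open>Laplacians, neighbourhoods and complements\<close>

definition lap_kernel :: "'v ugraph \<Rightarrow> 'v \<Rightarrow> 'v \<Rightarrow> int" where
  "lap_kernel G a b = (if a = b then int (degree_of G a) else 0) - (if {a, b} \<in> edges G then 1 else 0)"

lemma laplacian_eq_kernel_mat:
  "distinct xs \<Longrightarrow> laplacian G xs = kernel_mat (\<lambda>a b. of_int (lap_kernel G a b)) xs xs"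
  by (rule eq_matI)
    (auto simp: laplacian_def degree_matrix_def adjacency_matrix_def kernel_mat_def lap_kernel_def
      nth_eq_iff_index_eq)

definition neighbours :: "'v ugraph \<Rightarrow> 'v \<Rightarrow> 'v set" where
  "neighbours G v = {w \<in> verts G. {v, w} \<in> edges G}"

lemma simple_graph_edge:
  assumes "simple_graph G" "{u, w} \<in> edges G"
  shows "u \<in> verts G" "w \<in> verts G" "u \<noteq> w"
  using assms by (auto simp: simple_graph_def)

text \<open>An edge at \<open>v\<close> is determined by its other endpoint. Degrees in the joins
  can then be computed by counting disjoint vertex sets instead of edges.\<close>

lemma degree_of_eq_card_neighbours:
  assumes G: "simple_graph G"
  shows "degree_of G v = card (neighbours G v)"
proof -
  have "{e \<in> edges G. v \<in> e} = (\<lambda>w. {v, w}) ` neighbours G v"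
  proof (intro equalityI subsetI)
    fix e assume e: "e \<in> {e \<in> edges G. v \<in> e}"
    with G have "card e = 2" by (auto simp: simple_graph_def)
    with e obtain w where "e = {v, w}" by (auto simp: card_2_iff doubleton_eq_iff)
    with e G show "e \<in> (\<lambda>w. {v, w}) ` neighbours G v"
      by (auto simp: neighbours_def dest: simple_graph_edge)
  qed (auto simp: neighbours_def)
  moreover have "inj_on (\<lambda>w. {v, w}) (neighbours G v)"
    by (auto simp: inj_on_def doubleton_eq_iff)
  ultimately show ?thesis by (simp add: degree_of_def card_image)
qed

lemma complement_sel [simp]:
  "verts (complement G) = verts G"
  "{u, w} \<in> edges (complement G) \<longleftrightarrow> u \<in> verts G \<and> w \<in> verts G \<and> u \<noteq> w \<and> {u, w} \<notin> edges G"
  by (auto simp: complement_def doubleton_eq_iff insert_commute)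

lemma simple_graph_complement: "simple_graph G \<Longrightarrow> simple_graph (complement G)"
  by (auto simp: simple_graph_def complement_def card_2_iff)

text \<open>The vertex \<open>v\<close>, its neighbours and its non-neighbours partition the vertex
  set; the absence of loops keeps \<open>v\<close> out of its own neighbourhood.\<close>

lemma degree_of_complement:
  assumes G: "simple_graph G" and v: "v \<in> verts G"
  shows "degree_of (complement G) v + degree_of G v + 1 = card (verts G)"
proof -
  have fin: "finite (verts G)" using G by (simp add: simple_graph_def)
  have "verts G = insert v (neighbours (complement G) v \<union> neighbours G v)"
    using v by (auto simp: neighbours_def)
  moreover have "card (insert v (neighbours (complement G) v \<union> neighbours G v))
      = Suc (card (neighbours (complement G) v \<union> neighbours G v))"
    using fin simple_graph_edge(3)[OF G, of v v] by (intro card_insert_disjoint) (auto simp: neighbours_def)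
  moreover have "card (neighbours (complement G) v \<union> neighbours G v)
      = card (neighbours (complement G) v) + card (neighbours G v)"
    using fin by (intro card_Un_disjoint) (auto simp: neighbours_def)
  ultimately show ?thesis
    by (simp add: degree_of_eq_card_neighbours G simple_graph_complement)
qed

section \<open>Edges and degrees of the splitting join\<close>

definition splitting_join :: "'a ugraph \<Rightarrow> 'a ugraph \<Rightarrow> 'b ugraph \<Rightarrow> (('a + 'b) + 'a) ugraph" where
  "splitting_join H G1 G2 = \<lparr>verts = Inl ` verts (join G1 G2) \<union> Inr ` verts G1,
     edges = (`) Inl ` edges (join G1 G2)
       \<union> {{Inr u, Inl (Inl w)} | u w. u \<in> verts G1 \<and> w \<in> verts G1 \<and> {u, w} \<in> edges H}\<rparr>"

lemma ns_join_eq_splitting_join: "ns_join G1 G2 = splitting_join G1 G1 G2"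
  by (simp add: ns_join_def splitting_join_def)

lemma nns_join_eq_splitting_join: "nns_join G1 G2 = splitting_join (complement G1) G1 G2"
  by (simp add: nns_join_def splitting_join_def cong: conj_cong)

text \<open>The image map on sets inherits injectivity from \<open>f\<close>. This recovers the
  edges that \<open>Inl\<close> and \<open>Inr\<close> carry into the joins.\<close>

lemma doubleton_in_image_image:
  "inj f \<Longrightarrow> {f a, f b} \<in> (`) f ` E \<longleftrightarrow> {a, b} \<in> E"
  using inj_image_mem_iff[of "(`) f" "{a, b}" E] by (simp add: inj_on_image_Pow[of f UNIV, simplified])

lemma Inr_notin_image_Inl: "Inr u \<in> e \<Longrightarrow> e \<notin> (`) Inl ` E"
  by auto

lemma Inl_notin_image_Inr: "Inl u \<in> e \<Longrightarrow> e \<notin> (`) Inr ` E"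
  by auto

lemma join_edges:
  "{Inl u, Inl w} \<in> edges (join G1 G2) \<longleftrightarrow> {u, w} \<in> edges G1"
  "{Inr v, Inr v'} \<in> edges (join G1 G2) \<longleftrightarrow> {v, v'} \<in> edges G2"
  "{Inl u, Inr v} \<in> edges (join G1 G2) \<longleftrightarrow> u \<in> verts G1 \<and> v \<in> verts G2"
  "{Inr v, Inl u} \<in> edges (join G1 G2) \<longleftrightarrow> u \<in> verts G1 \<and> v \<in> verts G2"
  by (auto simp: join_def doubleton_in_image_image Inr_notin_image_Inl Inl_notin_image_Inr
      doubleton_eq_iff)

lemma splitting_join_edges:
  "{Inl p, Inl q} \<in> edges (splitting_join H G1 G2) \<longleftrightarrow> {p, q} \<in> edges (join G1 G2)"
  "{Inr u, Inl (Inl w)} \<in> edges (splitting_join H G1 G2)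
    \<longleftrightarrow> u \<in> verts G1 \<and> w \<in> verts G1 \<and> {u, w} \<in> edges H"
  "{Inl (Inl w), Inr u} \<in> edges (splitting_join H G1 G2)
    \<longleftrightarrow> u \<in> verts G1 \<and> w \<in> verts G1 \<and> {u, w} \<in> edges H"
  "{Inr u, Inl (Inr v)} \<notin> edges (splitting_join H G1 G2)"
  "{Inl (Inr v), Inr u} \<notin> edges (splitting_join H G1 G2)"
  "{Inr u, Inr w} \<notin> edges (splitting_join H G1 G2)"
  by (auto simp: splitting_join_def doubleton_in_image_image Inr_notin_image_Inl doubleton_eq_iff)

lemma simple_graph_join:
  assumes "simple_graph G1" "simple_graph G2"
  shows "simple_graph (join G1 G2)"
  unfolding simple_graph_def
proof (intro conjI ballI)
  show "finite (verts (join G1 G2))"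
    using assms by (simp add: join_def simple_graph_def)
  fix e assume "e \<in> edges (join G1 G2)"
  then consider e' where "e = Inl ` e'" "e' \<in> edges G1" | e' where "e = Inr ` e'" "e' \<in> edges G2"
    | u v where "e = {Inl u, Inr v}" "u \<in> verts G1" "v \<in> verts G2"
    by (auto simp: join_def)
  then have "e \<subseteq> verts (join G1 G2) \<and> card e = 2"
    using assms by cases (force simp: simple_graph_def join_def card_image)+
  then show "e \<subseteq> verts (join G1 G2)" "card e = 2" by auto
qed

lemma simple_graph_splitting_join:
  assumes "simple_graph G1" "simple_graph G2"
  shows "simple_graph (splitting_join H G1 G2)"
  unfolding simple_graph_def
proof (intro conjI ballI)
  let ?J = "splitting_join H G1 G2"
  note join = simple_graph_join[OF assms]
  show "finite (verts ?J)"
    using assms join by (simp add: splitting_join_def simple_graph_def)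
  fix e assume "e \<in> edges ?J"
  then consider e' where "e = Inl ` e'" "e' \<in> edges (join G1 G2)"
    | u w where "e = {Inr u, Inl (Inl w)}" "u \<in> verts G1" "w \<in> verts G1"
    by (auto simp: splitting_join_def)
  then have "e \<subseteq> verts ?J \<and> card e = 2"
  proof cases
    case 1
    with join have "e' \<subseteq> verts (join G1 G2)" "card e' = 2" by (auto simp: simple_graph_def)
    with 1 show ?thesis by (auto simp: splitting_join_def card_image)
  next
    case 2
    then show ?thesis by (auto simp: splitting_join_def join_def)
  qed
  then show "e \<subseteq> verts ?J" "card e = 2" by auto
qed

text \<open>Each neighbourhood is a disjoint union of injective images. The contributions of
  \<open>G2\<close>, \<open>G1\<close> and \<open>H\<close> produce the shifts by \<open>n2\<close>
  and \<open>n1\<close> and the occurrences of \<open>DH\<close> in the diagonal blocks.\<close>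

lemma splitting_join_degrees:
  assumes G1: "simple_graph G1" and G2: "simple_graph G2" and H: "simple_graph H"
    and VH: "verts H = verts G1"
  shows "u \<in> verts G1 \<Longrightarrow> degree_of (splitting_join H G1 G2) (Inl (Inl u))
      = degree_of G1 u + card (verts G2) + degree_of H u"
    and "v \<in> verts G2 \<Longrightarrow> degree_of (splitting_join H G1 G2) (Inl (Inr v))
      = card (verts G1) + degree_of G2 v"
    and "u \<in> verts G1 \<Longrightarrow> degree_of (splitting_join H G1 G2) (Inr u) = degree_of H u"
proof -
  let ?J = "splitting_join H G1 G2"
  note deg = degree_of_eq_card_neighbours[OF simple_graph_splitting_join[OF G1 G2]]
    degree_of_eq_card_neighbours[OF G1] degree_of_eq_card_neighbours[OF G2]
    degree_of_eq_card_neighbours[OF H]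
  have fin: "finite (verts G1)" "finite (verts G2)"
    using G1 G2 by (auto simp: simple_graph_def)
  then have finN: "finite (neighbours G1 u)" "finite (neighbours G2 v)" "finite (neighbours H u)" for u v
    by (auto simp: neighbours_def VH)
  have V: "verts ?J = (Inl \<circ> Inl) ` verts G1 \<union> (Inl \<circ> Inr) ` verts G2 \<union> Inr ` verts G1"
    by (auto simp: splitting_join_def join_def)
  have inj: "inj_on (Inl \<circ> Inl) A" "inj_on (Inl \<circ> Inr) A" "inj_on Inr A" for A
    by (auto simp: inj_on_def)
  show "degree_of ?J (Inl (Inl u)) = degree_of G1 u + card (verts G2) + degree_of H u"
    if "u \<in> verts G1"
  proof -
    let ?A = "(Inl \<circ> Inl) ` neighbours G1 u :: (('a + 'b) + 'a) set"
    let ?B = "(Inl \<circ> Inr) ` verts G2 :: (('a + 'b) + 'a) set"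
    let ?C = "Inr ` neighbours H u :: (('a + 'b) + 'a) set"
    have "neighbours ?J (Inl (Inl u)) = ?A \<union> ?B \<union> ?C"
      using that unfolding neighbours_def V
      by (auto simp: splitting_join_edges join_edges VH insert_commute)
    moreover have "card (?A \<union> ?B \<union> ?C) = card (?A \<union> ?B) + card ?C"
      using fin finN by (intro card_Un_disjoint) auto
    moreover have "card (?A \<union> ?B) = card ?A + card ?B"
      using fin finN by (intro card_Un_disjoint) auto
    moreover have "card ?A = card (neighbours G1 u)" "card ?B = card (verts G2)"
      "card ?C = card (neighbours H u)"
      by (simp_all only: card_image inj)
    ultimately show ?thesis by (simp add: deg)
  qed
  show "degree_of ?J (Inl (Inr v)) = card (verts G1) + degree_of G2 v" if "v \<in> verts G2"
  proof -
    let ?A = "(Inl \<circ> Inl) ` verts G1 :: (('a + 'b) + 'a) set"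
    let ?B = "(Inl \<circ> Inr) ` neighbours G2 v :: (('a + 'b) + 'a) set"
    have "neighbours ?J (Inl (Inr v)) = ?A \<union> ?B"
      using that unfolding neighbours_def V
      by (auto simp: splitting_join_edges join_edges)
    moreover have "card (?A \<union> ?B) = card ?A + card ?B"
      using fin finN by (intro card_Un_disjoint) auto
    moreover have "card ?A = card (verts G1)" "card ?B = card (neighbours G2 v)"
      by (simp_all only: card_image inj)
    ultimately show ?thesis by (simp add: deg)
  qed
  show "degree_of ?J (Inr u) = degree_of H u" if "u \<in> verts G1"
  proof -
    have "neighbours ?J (Inr u) = (Inl \<circ> Inl) ` neighbours H u"
      using that unfolding neighbours_def V
      by (auto simp: splitting_join_edges join_edges VH)
    then show ?thesis by (simp only: deg card_image inj)
  qed
qed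

section \<open>The Laplacian characteristic polynomial of the splitting join\<close>

theorem char_poly_laplacian_splitting_join:
  fixes G1 H :: "'a ugraph" and G2 :: "'b ugraph"
  assumes G1: "simple_graph G1" and G2: "simple_graph G2" and H: "simple_graph H"
    and VH: "verts H = verts G1"
    and us: "vertex_enum G1 us" and vs: "vertex_enum G2 vs"
    and ws: "vertex_enum (splitting_join H G1 G2) ws"
    and n1: "card (verts G1) = n1" and n2: "card (verts G2) = n2"
  defines "x \<equiv> ratfun_X"
    and "AH \<equiv> adjacency_matrix H us" and "DH \<equiv> degree_matrix H us"
  defines "N \<equiv> mat_inv (x \<cdot>\<^sub>m 1\<^sub>m n1 - DH)"
  shows "poly_ratfun (char_poly (laplacian (splitting_join H G1 G2) ws)) =
      det ((x - of_nat n1) \<cdot>\<^sub>m 1\<^sub>m n2 - laplacian G2 vs) * det (x \<cdot>\<^sub>m 1\<^sub>m n1 - DH)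
      * det ((x - of_nat n2) \<cdot>\<^sub>m 1\<^sub>m n1 - laplacian G1 us - DH - AH * N * AH)
      * (1 - coronal (laplacian G2 vs) (x - of_nat n1)
           * coronal (laplacian G1 us + DH + AH * N * AH) (x - of_nat n2))"
proof -
  let ?J = "splitting_join H G1 G2"
  let ?k = "char_kernel (lap_kernel ?J)"
  let ?vs = "map (Inl \<circ> Inr) vs :: (('a + 'b) + 'a) list"
  let ?us' = "map Inr us :: (('a + 'b) + 'a) list"
  let ?us = "map (Inl \<circ> Inl) us :: (('a + 'b) + 'a) list"
  let ?W = "x \<cdot>\<^sub>m 1\<^sub>m n1 - DH"
  let ?P = "(x - of_nat n2) \<cdot>\<^sub>m 1\<^sub>m n1 - laplacian G1 us - DH"
  let ?Q = "(x - of_nat n1) \<cdot>\<^sub>m 1\<^sub>m n2 - laplacian G2 vs"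
  have us': "distinct us" "set us = verts G1" "length us = n1"
    and vs': "distinct vs" "set vs = verts G2" "length vs = n2"
    and ws': "distinct ws" "set ws = verts ?J"
    using us vs ws n1 n2 distinct_card[of us] distinct_card[of vs] by (auto simp: vertex_enum_def)
  have mem: "i < n1 \<Longrightarrow> us ! i \<in> verts G1" "j < n2 \<Longrightarrow> vs ! j \<in> verts G2" for i j
    using us' vs' nth_mem[of i us] nth_mem[of j vs] by auto
  note deg = splitting_join_degrees[OF G1 G2 H VH]
  note simps = kernel_mat_def char_kernel_def lap_kernel_def splitting_join_edges join_edges
    laplacian_def degree_matrix_def adjacency_matrix_def us' vs' mem deg n1 n2
    nth_eq_iff_index_eq AH_def DH_def x_def
  have Q: "kernel_mat ?k ?vs ?vs = ?Q"
    by (rule eq_matI) (auto simp: simps)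
  have W: "kernel_mat ?k ?us' ?us' = ?W"
    by (rule eq_matI) (auto simp: simps)
  have P: "kernel_mat ?k ?us ?us = ?P"
    by (rule eq_matI) (auto simp: simps)
  \<comment> \<open>An edge contributes -1 to the Laplacian and hence +1 to these blocks. Edges are
    unordered, so both mixed blocks are the same matrix.\<close>
  have B: "kernel_mat ?k ?us' ?us = AH" "kernel_mat ?k ?us ?us' = AH"
    by (rule eq_matI; auto simp: simps insert_commute)+
  have K: "kernel_mat ?k ?vs (?us' @ ?us) = mat n2 (n1 + n1) (\<lambda>(i, j). if j < n1 then 0 else 1)"
    by (rule eq_matI) (auto simp: simps nth_append)
  have T: "kernel_mat ?k (?us' @ ?us) ?vs = mat (n1 + n1) n2 (\<lambda>(i, j). if i < n1 then 0 else 1)"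
    by (rule eq_matI) (auto simp: simps nth_append)
  have M: "kernel_mat ?k (?us' @ ?us) (?us' @ ?us) = four_block_mat ?W AH AH ?P"
    by (simp only: kernel_mat_append W B P)
  have d: "distinct ?vs" "distinct ?us'" "distinct (?us' @ ?us)" "distinct (?vs @ ?us' @ ?us)"
    using us' vs' by (auto simp: distinct_map inj_on_def)
  \<comment> \<open>All three blocks are restrictions of the one kernel \<open>?k\<close> to
    distinct lists of vertices, so no separate nonsingularity argument is needed for any of
    them.\<close>
  have nz: "det ?Q \<noteq> 0" "det ?W \<noteq> 0" "det (four_block_mat ?W AH AH ?P) \<noteq> 0"
    using det_char_kernel_nonzero[OF d(1), of "lap_kernel ?J"]
      det_char_kernel_nonzero[OF d(2), of "lap_kernel ?J"]
      det_char_kernel_nonzero[OF d(3), of "lap_kernel ?J"]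
    by (simp_all only: Q W M not_False_eq_True)
  have c: "?Q \<in> carrier_mat n2 n2" "?W \<in> carrier_mat n1 n1" "AH \<in> carrier_mat n1 n1"
    "?P \<in> carrier_mat n1 n1" "laplacian G1 us \<in> carrier_mat n1 n1" "DH \<in> carrier_mat n1 n1"
    "laplacian G2 vs \<in> carrier_mat n2 n2"
    using us'(3) vs'(3) by (auto simp: laplacian_def degree_matrix_def adjacency_matrix_def AH_def DH_def)
  have N: "N \<in> carrier_mat n1 n1"
    unfolding N_def by (rule mat_inv_right_left(3)[OF c(2) nz(2)])
  have "set ws = set (?vs @ ?us' @ ?us)"
    by (simp add: ws'(2) us'(2) vs'(2) splitting_join_def join_def image_Un image_comp ac_simps)
  then have "det (kernel_mat ?k ws ws) = det (kernel_mat ?k (?vs @ ?us' @ ?us) (?vs @ ?us' @ ?us))"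
    by (rule det_kernel_mat_reorder[OF ws'(1) d(4)])
  then have "poly_ratfun (char_poly (laplacian ?J ws))
      = det (kernel_mat ?k (?vs @ ?us' @ ?us) (?vs @ ?us' @ ?us))"
    by (simp only: laplacian_eq_kernel_mat[OF ws'(1)] poly_ratfun_char_poly[OF ws'(1)])
  also have "\<dots> = det (four_block_mat ?Q (mat n2 (n1 + n1) (\<lambda>(i, j). if j < n1 then 0 else 1))
      (mat (n1 + n1) n2 (\<lambda>(i, j). if i < n1 then 0 else 1)) (four_block_mat ?W AH AH ?P))"
    by (simp only: kernel_mat_append[of _ ?vs] Q K T M)
  also have "\<dots> = det ?Q * det ?W * det (?P - AH * N * AH)
      * (1 - (ones_vec n2 \<bullet> (mat_inv ?Q *\<^sub>v ones_vec n2))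
          * (ones_vec n1 \<bullet> (mat_inv (?P - AH * N * AH) *\<^sub>v ones_vec n1)))"
    unfolding N_def by (rule det_join_block[OF c(1,2,3,3,4) nz])
  also have "ones_vec n2 \<bullet> (mat_inv ?Q *\<^sub>v ones_vec n2) = coronal (laplacian G2 vs) (x - of_nat n1)"
    by (rule coronal_eq[OF c(7), symmetric])
  also have "ones_vec n1 \<bullet> (mat_inv (?P - AH * N * AH) *\<^sub>v ones_vec n1)
      = coronal (laplacian G1 us + DH + AH * N * AH) (x - of_nat n2)"
  proof -
    \<comment> \<open>The last Schur complement already has the form \<open>y I - M\<close> with
      \<open>y = x - n2\<close>, which identifies the sum of the entries of its inverse as a
      coronal.\<close>
    have "?P - AH * N * AH = (x - of_nat n2) \<cdot>\<^sub>m 1\<^sub>m n1 - (laplacian G1 us + DH + AH * N * AH)"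
      using c N by (intro eq_matI) (auto simp: carrier_matD[OF c(5)] carrier_matD[OF c(6)])
    moreover have "laplacian G1 us + DH + AH * N * AH \<in> carrier_mat n1 n1" using c N by auto
    ultimately show ?thesis by (simp add: coronal_eq)
  qed
  finally show ?thesis .
qed

section \<open>Specialisation to the NNS and NS joins\<close>

theorem theorem4p2:
  fixes G1 :: "'a ugraph" and G2 :: "'b ugraph"
    and us :: "'a list" and vs :: "'b list"
    and ws ws' :: "(('a + 'b) + 'a) list"
    and n1 n2 :: nat
  assumes "simple_graph G1" and "simple_graph G2"
    and "card (verts G1) = n1" and "card (verts G2) = n2"
    and "vertex_enum G1 us" and "vertex_enum G2 vs"
    and "vertex_enum (nns_join G1 G2) ws" and "vertex_enum (ns_join G1 G2) ws'"
  shows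
    "let x = ratfun_X;
         I1 = 1\<^sub>m n1; I2 = 1\<^sub>m n2;
         A1 = adjacency_matrix G1 us; Ac1 = adjacency_matrix (complement G1) us;
         D1 = degree_matrix G1 us; L1 = laplacian G1 us; L2 = laplacian G2 vs
     in
       poly_ratfun (char_poly (laplacian (nns_join G1 G2) ws)) =
         det ((x - of_nat n1) \<cdot>\<^sub>m I2 - L2)
         * det ((x - of_nat n1 + 1) \<cdot>\<^sub>m I1 + D1)
         * det ((x - of_nat n1 - of_nat n2 + 1) \<cdot>\<^sub>m I1 - L1 + D1
                - Ac1 * mat_inv ((x - of_nat n1 + 1) \<cdot>\<^sub>m I1 + D1) * Ac1)
         * (1 - coronal L2 (x - of_nat n1)
                * coronal (L1 - D1 + Ac1 * mat_inv ((x - of_nat n1 + 1) \<cdot>\<^sub>m I1 + D1) * Ac1)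
                    (x - of_nat n1 - of_nat n2 + 1))
     \<and>
       poly_ratfun (char_poly (laplacian (ns_join G1 G2) ws')) =
         det ((x - of_nat n1) \<cdot>\<^sub>m I2 - L2)
         * det (x \<cdot>\<^sub>m I1 - D1)
         * det ((x - of_nat n2) \<cdot>\<^sub>m I1 - L1 - D1 - A1 * mat_inv (x \<cdot>\<^sub>m I1 - D1) * A1)
         * (1 - coronal L2 (x - of_nat n1)
                * coronal (L1 + D1 + A1 * mat_inv (x \<cdot>\<^sub>m I1 - D1) * A1) (x - of_nat n2))"
proof -
  have us: "length us = n1" "\<And>i. i < n1 \<Longrightarrow> us ! i \<in> verts G1"
    using assms(3,5) distinct_card[of us] nth_mem[of _ us] by (auto simp: vertex_enum_def)
  let ?x = ratfun_X
  let ?D = "degree_matrix G1 us :: ratfun mat"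
    and ?Dc = "degree_matrix (complement G1) us :: ratfun mat"
  let ?L = "laplacian G1 us :: ratfun mat"
  \<comment> \<open>The degrees of a vertex in a graph and in its complement add up to
    \<open>n1 - 1\<close>. Eliminating \<open>?Dc\<close> in this way is the source of the summand
    \<open>1 - n1\<close> and of the reversed sign of \<open>D(G1)\<close> in the NNS
    formula.\<close>
  have Dc: "?Dc = (of_nat n1 - 1) \<cdot>\<^sub>m 1\<^sub>m n1 - ?D"
  proof (rule eq_matI)
    fix i j
    assume ij: "i < dim_row ((of_nat n1 - 1) \<cdot>\<^sub>m 1\<^sub>m n1 - ?D)"
      "j < dim_col ((of_nat n1 - 1) \<cdot>\<^sub>m 1\<^sub>m n1 - ?D)"
    then have "i < n1" "j < n1" using us by (auto simp: degree_matrix_def)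
    moreover have "of_nat (degree_of (complement G1) (us ! i) + degree_of G1 (us ! i) + 1)
        = (of_nat n1 :: ratfun)"
      using degree_of_complement[OF assms(1) us(2)[OF \<open>i < n1\<close>]] assms(3) by simp
    ultimately show "?Dc $$ (i, j) = ((of_nat n1 - 1) \<cdot>\<^sub>m 1\<^sub>m n1 - ?D) $$ (i, j)"
      using us(1) by (auto simp: degree_matrix_def algebra_simps)
  qed (auto simp: degree_matrix_def us)
  have carr: "?D \<in> carrier_mat n1 n1" "?L \<in> carrier_mat n1 n1"
    using us(1) by (auto simp: degree_matrix_def laplacian_def adjacency_matrix_def)
  have W: "?x \<cdot>\<^sub>m 1\<^sub>m n1 - ?Dc = (?x - of_nat n1 + 1) \<cdot>\<^sub>m 1\<^sub>m n1 + ?D"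
    unfolding Dc using carr
    by (intro eq_matI) (auto simp: carrier_matD[OF carr(1)] carrier_matD[OF carr(2)])
  have P: "(?x - of_nat n2) \<cdot>\<^sub>m 1\<^sub>m n1 - ?L - ?Dc = (?x - of_nat n1 - of_nat n2 + 1) \<cdot>\<^sub>m 1\<^sub>m n1 - ?L + ?D"
    unfolding Dc using carr
    by (intro eq_matI) (auto simp: carrier_matD[OF carr(1)] carrier_matD[OF carr(2)])
  \<comment> \<open>A coronal depends only on \<open>y I - M\<close>, so the scalar part of
    \<open>?Dc\<close> can be moved from the matrix into the argument.\<close>
  have cor: "coronal (?L + ?Dc + M) (?x - of_nat n2) = coronal (?L - ?D + M) (?x - of_nat n1 - of_nat n2 + 1)"
    if "M \<in> carrier_mat n1 n1" for M
  proof -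
    have "(?x - of_nat n2) \<cdot>\<^sub>m 1\<^sub>m n1 - (?L + ?Dc + M)
        = (?x - of_nat n1 - of_nat n2 + 1) \<cdot>\<^sub>m 1\<^sub>m n1 - (?L - ?D + M)"
      unfolding Dc using carr that
      by (intro eq_matI) (auto simp: carrier_matD[OF carr(1)] carrier_matD[OF carr(2)])
    moreover have "?L + ?Dc + M \<in> carrier_mat n1 n1" "?L - ?D + M \<in> carrier_mat n1 n1"
      using that carr by (auto simp: Dc)
    ultimately show ?thesis by (simp add: coronal_eq)
  qed
  have M: "adjacency_matrix (complement G1) us * X * adjacency_matrix (complement G1) us
      \<in> carrier_mat n1 n1" for X :: "ratfun mat"
    using us(1) by (intro carrier_matI) (auto simp: adjacency_matrix_def)
  note nns = char_poly_laplacian_splitting_join[OF assms(1,2) simple_graph_complement[OF assms(1)]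
      complement_sel(1) assms(5,6) assms(7)[unfolded nns_join_eq_splitting_join] assms(3,4),
      unfolded W P cor[OF M]]
  note ns = char_poly_laplacian_splitting_join[OF assms(1,2,1) refl assms(5,6)
      assms(8)[unfolded ns_join_eq_splitting_join] assms(3,4)]
  show ?thesis
    unfolding Let_def nns_join_eq_splitting_join ns_join_eq_splitting_join
    using nns ns by (rule conjI)
qed

end
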